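(* Let $(A,\{\,,\,,\,\}_i)$ be an associative triple trisystem of the second kind over $\phi$, and let $\bar A$ be an isomorphic copy of $A$ (with $y\mapsto\bar y$). Then $\mathfrak L(A,A)\oplus A\oplus\bar A\oplus\mathfrak R(A,A)^{\mathrm{op}}$, with elements written as matrices $\begin{pmatrix}\lambda&x\\ \bar y&\rho\end{pmatrix}$ and products $$\begin{pmatrix}\lambda_1&x_1\\ \bar y_1&\rho_1\end{pmatrix}\dashv\begin{pmatrix}\lambda_2&x_2\\ \bar y_2&\rho_2\end{pmatrix}=\begin{pmatrix}\lambda_1\dashv\lambda_2+L^\triangleleft(x_1,y_2)&\lambda_1\prec x_2+x_1\prec\rho_2\\ \overline{y_1\prec^*\lambda_2}+\overline{\rho_1\prec^* y_2}&R^\triangleleft(y_1,x_2)+\rho_1\dashv\rho_2\end{pmatrix}$$ and $$\begin{pmatrix}\lambda_1&x_1\\ \bar y_1&\rho_1\end{pmatrix}\vdash\begin{pmatrix}\lambda_2&x_2\\ \bar y_2&\rho_2\end{pmatrix}=\begin{pmatrix}\lambda_1\vdash\lambda_2+L^\triangleright(x_1,y_2)&\lambda_1\succ x_2+x_1\succ\rho_2\\ \overline{y_1\succ^*\lambda_2}+\overline{\rho_1\succ^* y_2}&R^\triangleright(y_1,x_2)+\rho_1\vdash\rho_2\end{pmatrix}$$ for all $\lambda_1,\lambda_2\in\mathfrak L(A,A)$, $x_1,x_2\in A$, $\bar y_1,\bar y_2\in\bar A$, $\rho_1,\rho_2\in\mathfrak R(A,A)^{\mathrm{op}}$, is an associative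 dialgebra. Moreover, $$\begin{pmatrix}\lambda&x\\ \bar y&\rho\end{pmatrix}^\star:=\begin{pmatrix}\lambda^*&y\\ \bar x&\rho^*\end{pmatrix}$$ is an involution of $\mathfrak L(A,A)\oplus A\oplus\bar A\oplus\mathfrak R(A,A)^{\mathrm{op}}$. Furthermore, identifying $x\in A$ with $\begin{pmatrix}0&x\\0&0\end{pmatrix}$, one has $\{x,y,z\}_1=x\dashv(y^\star\dashv z)$, $\{x,y,z\}_2=x\vdash(y^\star\dashv z)$ and $\{x,y,z\}_3=x\vdash(y^\star\vdash z)$ for all $x,y,z\in A$.
   Context: $\phi$ is a scalar ring (commutative, unital) with $\frac12\in\phi$. An associative dialgebra is a $\phi$-module $D$ with two bilinear products $\dashv,\vdash$ satisfying, for all $a,b,c\in D$: $(a\dashv b)\dashv c=a\dashv(b\dashv c)$; $(a\vdash b)\dashv c=a\vdash(b\dashv c)$; $(a\vdash b)\vdash c=a\vdash(b\vdash c)$; $a\dashv(b\dashv c)=a\dashv(b\vdash c)$; $(a\dashv b)\vdash c=(a\vdash b)\vdash c$. An involution of $D$ is a linear map $*:D\to D$ with $(a^* )^*=a$, $(a\dashv b)^*=b^*\vdash a^*$ and $(a\vdash b)^*=b^*\dashv a^*$. An associative triple trisystem of the second kind is a $\phi$-module $A$ with three trilinear maps $\{\,,\,,\,\}_i:A\times A\times A\to A$, $i\in\{1,2,3\}$, satisfying for all $a,b,c,d,e\in A$: (1) $\{\{a,b,c\}_1,d,e\}_1=\{a,\{d,c,b\}_1,e\}_1=\{a,b,\{c,d,e\}_1\}_1$;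 (2) $\{\{a,b,c\}_2,d,e\}_1=\{a,\{d,c,b\}_3,e\}_2=\{a,b,\{c,d,e\}_1\}_2$; (3) $\{\{a,b,c\}_3,d,e\}_1=\{a,\{d,c,b\}_2,e\}_2=\{a,b,\{c,d,e\}_1\}_3$; (4) $\{\{a,b,c\}_3,d,e\}_2=\{a,\{d,c,b\}_1,e\}_2=\{a,b,\{c,d,e\}_2\}_3$; (5) $\{\{a,b,c\}_3,d,e\}_3=\{a,\{d,c,b\}_3,e\}_3=\{a,b,\{c,d,e\}_3\}_3$; (6) $\{\{a,b,c\}_1,d,e\}_2=\{\{a,b,c\}_2,d,e\}_2=\{\{a,b,c\}_3,d,e\}_2$; (7) $\{\{a,b,c\}_1,d,e\}_3=\{\{a,b,c\}_2,d,e\}_3=\{\{a,b,c\}_3,d,e\}_3$; (8) $\{a,\{b,c,d\}_1,e\}_1=\{a,\{b,c,d\}_2,e\}_1=\{a,\{b,c,d\}_3,e\}_1$; (9) $\{a,\{b,c,d\}_1,e\}_3=\{a,\{b,c,d\}_2,e\}_3=\{a,\{b,c,d\}_3,e\}_3$; (10) $\{a,b,\{c,d,e\}_1\}_1=\{a,b,\{c,d,e\}_2\}_1=\{a,b,\{c,d,e\}_3\}_1$; (11) $\{a,b,\{c,d,e\}_1\}_2=\{a,b,\{c,d,e\}_2\}_2=\{a,b,\{c,d,e\}_3\}_2$. Di-endomorphisms. $\mathrm{DiEnd}(A)$ is the module $\mathrm{End}(A)\oplus\mathrm{End}(A)$ with actions $f\prec x:=f_1(x)$, $f\succ x:=f_2(x)$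 for $f=(f_1,f_2)$, $x\in A$, and products $f\dashv g:=(f_1\circ g_2,f_2\circ g_2)$, $f\vdash g:=(f_2\circ g_1,f_2\circ g_2)$. $\mathrm{DiEnd}(A)^{\mathrm{op}}$ is the same module, with right actions $x\prec f:=f_2(x)$, $x\succ f:=f_1(x)$ and opposite products: the product $f\dashv g$ in $\mathrm{DiEnd}(A)^{\mathrm{op}}$ is $g\vdash f$ computed in $\mathrm{DiEnd}(A)$, and the product $f\vdash g$ in $\mathrm{DiEnd}(A)^{\mathrm{op}}$ is $g\dashv f$ computed in $\mathrm{DiEnd}(A)$. Put $L_i(x,y)(z):=\{x,y,z\}_i$, $R_i(x,y)(z):=\{z,x,y\}_i$, and $L^\triangleleft(x,y)=(L_1(x,y),L_3(x,y))$, $L^\triangleright(x,y)=(L_2(x,y),L_3(x,y))$, $R^\triangleleft(x,y)=(R_2(x,y),R_1(x,y))$, $R^\triangleright(x,y)=(R_3(x,y),R_1(x,y))$. $\mathfrak L(A,A)\subset\mathrm{DiEnd}(A)$ is the $\phi$-submodule generated by all $L^\triangleleft(x,y),L^\triangleright(x,y)$, with the products and left actions of $\mathrm{DiEnd}(A)$; $\mathfrak R(A,A)^{\mathrm{op}}\subset\mathrm{DiEnd}(A)^{\mathrm{op}}$ is the $\phi$-submodule generated by all $R^\triangleleft(x,y),R^\triangleright(x,y)$, with the products and right actions of $\mathrm{DiEnd}(A)^{\mathrm{op}}$. Thus for example $x\prec R^\triangleleft(y,z)=x\prec R^\triangleright(y,z)=\{x,y,z\}_1$, $x\succ R^\triangleleft(y,z)=\{x,y,z\}_2$,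 $x\succ R^\triangleright(y,z)=\{x,y,z\}_3$. The linear map $*$ on $\mathfrak L(A,A)$ and on $\mathfrak R(A,A)^{\mathrm{op}}$ is defined on generators by $(L^\triangleleft(x,y))^*:=L^\triangleright(y,x)$, $(L^\triangleright(x,y))^*:=L^\triangleleft(y,x)$, $(R^\triangleleft(x,y))^*:=R^\triangleright(y,x)$, $(R^\triangleright(x,y))^*:=R^\triangleleft(y,x)$, extended linearly. The maps $\prec^*,\succ^*:A\times\mathfrak L(A,A)\to A$ are $x\prec^*\lambda:=\lambda^*\succ x$, $x\succ^*\lambda:=\lambda^*\prec x$, and the maps $\prec^*,\succ^*:\mathfrak R(A,A)^{\mathrm{op}}\times A\to A$ are $\rho\prec^* x:=x\succ\rho^*$, $\rho\succ^* x:=x\prec\rho^*$.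
   Formalization: The linear maps * on L(A,A) and R(A,A)^op with the prescribed values on generators are assumed to exist; this can fail, e.g. A free on v,w,z with only nonzero basis product {v,w,v}_2=z, where L^◁(w,v)=0 but L^▷(v,w)≠0. *)

theory Defs
  imports Complex_Main "HOL-Library.Function_Algebras" "HOL-Library.Product_Plus"
begin

text \<open>Modules are given by a scalar multiplication satisfying the locale \<^locale>\<open>module\<close>.  Since
  \<open>\<LL>(A,A)\<close> and \<open>\<RR>(A,A)\<^sup>o\<^sup>p\<close> are proper submodules of an ambient type, linearity and the dialgebra
  structure are relativised to a submodule \<open>D\<close>.\<close>

definition linear_map_on ::
  "('r::comm_ring_1 \<Rightarrow> 'm::ab_group_add \<Rightarrow> 'm) \<Rightarrow> 'm set \<Rightarrow> ('m \<Rightarrow> 'm) \<Rightarrow> bool" where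
  "linear_map_on scale D f \<longleftrightarrow>
     (\<forall>a\<in>D. f a \<in> D) \<and>
     (\<forall>a\<in>D. \<forall>b\<in>D. f (a + b) = f a + f b) \<and>
     (\<forall>r. \<forall>a\<in>D. f (scale r a) = scale r (f a))"

definition bilinear_map_on ::
  "('r::comm_ring_1 \<Rightarrow> 'm::ab_group_add \<Rightarrow> 'm) \<Rightarrow> 'm set \<Rightarrow> ('m \<Rightarrow> 'm \<Rightarrow> 'm) \<Rightarrow> bool" where
  "bilinear_map_on scale D m \<longleftrightarrow>
     (\<forall>a\<in>D. linear_map_on scale D (m a)) \<and>
     (\<forall>b\<in>D. linear_map_on scale D (\<lambda>a. m a b))"

locale assoc_dialgebra = module scale
  for scale :: "'r::comm_ring_1 \<Rightarrow> 'd::ab_group_add \<Rightarrow> 'd" +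
  fixes D :: "'d set"
    and left_prod :: "'d \<Rightarrow> 'd \<Rightarrow> 'd"  (infixl "\<stileturn>" 70)
    and right_prod :: "'d \<Rightarrow> 'd \<Rightarrow> 'd"  (infixl "\<turnstile>" 70)
  assumes submodule: "subspace D"
    and bilinear_left: "bilinear_map_on scale D (\<stileturn>)"
    and bilinear_right: "bilinear_map_on scale D (\<turnstile>)"
    and dialg1: "\<lbrakk>a \<in> D; b \<in> D; c \<in> D\<rbrakk> \<Longrightarrow> (a \<stileturn> b) \<stileturn> c = a \<stileturn> (b \<stileturn> c)"
    and dialg2: "\<lbrakk>a \<in> D; b \<in> D; c \<in> D\<rbrakk> \<Longrightarrow> (a \<turnstile> b) \<stileturn> c = a \<turnstile> (b \<stileturn> c)"
    and dialg3: "\<lbrakk>a \<in> D; b \<in> D; c \<in> D\<rbrakk> \<Longrightarrow> (a \<turnstile> b) \<turnstile> c = a \<turnstile> (b \<turnstile> c)"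
    and dialg4: "\<lbrakk>a \<in> D; b \<in> D; c \<in> D\<rbrakk> \<Longrightarrow> a \<stileturn> (b \<stileturn> c) = a \<stileturn> (b \<turnstile> c)"
    and dialg5: "\<lbrakk>a \<in> D; b \<in> D; c \<in> D\<rbrakk> \<Longrightarrow> (a \<stileturn> b) \<turnstile> c = (a \<turnstile> b) \<turnstile> c"

definition dialgebra_involution ::
  "('r::comm_ring_1 \<Rightarrow> 'd::ab_group_add \<Rightarrow> 'd) \<Rightarrow> 'd set \<Rightarrow>
   ('d \<Rightarrow> 'd \<Rightarrow> 'd) \<Rightarrow> ('d \<Rightarrow> 'd \<Rightarrow> 'd) \<Rightarrow> ('d \<Rightarrow> 'd) \<Rightarrow> bool" where
  "dialgebra_involution scale D left_prod right_prod star \<longleftrightarrow>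
     linear_map_on scale D star \<and>
     (\<forall>a\<in>D. star (star a) = a) \<and>
     (\<forall>a\<in>D. \<forall>b\<in>D. star (left_prod a b) = right_prod (star b) (star a)) \<and>
     (\<forall>a\<in>D. \<forall>b\<in>D. star (right_prod a b) = left_prod (star b) (star a))"

definition trilinear_map ::
  "('r::comm_ring_1 \<Rightarrow> 'a::ab_group_add \<Rightarrow> 'a) \<Rightarrow> ('a \<Rightarrow> 'a \<Rightarrow> 'a \<Rightarrow> 'a) \<Rightarrow> bool" where
  "trilinear_map scale t \<longleftrightarrow>
     (\<forall>y z. module_hom scale scale (\<lambda>x. t x y z)) \<and>
     (\<forall>x z. module_hom scale scale (\<lambda>y. t x y z)) \<and>
     (\<forall>x y. module_hom scale scale (\<lambda>z. t x y z))"

locale assoc_triple_trisystem_2 = module scale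
  for scale :: "'r::comm_ring_1 \<Rightarrow> 'a::ab_group_add \<Rightarrow> 'a" +
  fixes t1 :: "'a \<Rightarrow> 'a \<Rightarrow> 'a \<Rightarrow> 'a"
    and t2 :: "'a \<Rightarrow> 'a \<Rightarrow> 'a \<Rightarrow> 'a"
    and t3 :: "'a \<Rightarrow> 'a \<Rightarrow> 'a \<Rightarrow> 'a"
  assumes trilinear: "trilinear_map scale t1" "trilinear_map scale t2" "trilinear_map scale t3"
    and tri1: "t1 (t1 a b c) d e = t1 a (t1 d c b) e" "t1 a (t1 d c b) e = t1 a b (t1 c d e)"
    and tri2: "t1 (t2 a b c) d e = t2 a (t3 d c b) e" "t2 a (t3 d c b) e = t2 a b (t1 c d e)"
    and tri3: "t1 (t3 a b c) d e = t2 a (t2 d c b) e" "t2 a (t2 d c b) e = t3 a b (t1 c d e)"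
    and tri4: "t2 (t3 a b c) d e = t2 a (t1 d c b) e" "t2 a (t1 d c b) e = t3 a b (t2 c d e)"
    and tri5: "t3 (t3 a b c) d e = t3 a (t3 d c b) e" "t3 a (t3 d c b) e = t3 a b (t3 c d e)"
    and tri6: "t2 (t1 a b c) d e = t2 (t2 a b c) d e" "t2 (t2 a b c) d e = t2 (t3 a b c) d e"
    and tri7: "t3 (t1 a b c) d e = t3 (t2 a b c) d e" "t3 (t2 a b c) d e = t3 (t3 a b c) d e"
    and tri8: "t1 a (t1 b c d) e = t1 a (t2 b c d) e" "t1 a (t2 b c d) e = t1 a (t3 b c d) e"
    and tri9: "t3 a (t1 b c d) e = t3 a (t2 b c d) e" "t3 a (t2 b c d) e = t3 a (t3 b c d) e"
    and tri10: "t1 a b (t1 c d e) = t1 a b (t2 c d e)" "t1 a b (t2 c d e) = t1 a b (t3 c d e)"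
    and tri11: "t2 a b (t1 c d e) = t2 a b (t2 c d e)" "t2 a b (t2 c d e) = t2 a b (t3 c d e)"

type_synonym 'a dimap = "('a \<Rightarrow> 'a) \<times> ('a \<Rightarrow> 'a)"

definition dimap_scale :: "('r \<Rightarrow> 'a \<Rightarrow> 'a) \<Rightarrow> 'r \<Rightarrow> 'a dimap \<Rightarrow> 'a dimap" where
  "dimap_scale scale r f = ((\<lambda>x. scale r (fst f x)), (\<lambda>x. scale r (snd f x)))"

definition DiEnd :: "('r::comm_ring_1 \<Rightarrow> 'a::ab_group_add \<Rightarrow> 'a) \<Rightarrow> 'a dimap set" where
  "DiEnd scale = {f. module_hom scale scale (fst f) \<and> module_hom scale scale (snd f)}"

text \<open>Operations with index \<open>E\<close> belong to \<open>DiEnd(A)\<close>, those with index \<open>O\<close> to \<open>DiEnd(A)\<^sup>o\<^sup>p\<close>.\<close>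

definition E_prec :: "'a dimap \<Rightarrow> 'a \<Rightarrow> 'a"  (infixr "\<prec>\<^sub>E" 75) where
  "f \<prec>\<^sub>E x = fst f x"

definition E_succ :: "'a dimap \<Rightarrow> 'a \<Rightarrow> 'a"  (infixr "\<succ>\<^sub>E" 75) where
  "f \<succ>\<^sub>E x = snd f x"

definition E_left :: "'a dimap \<Rightarrow> 'a dimap \<Rightarrow> 'a dimap"  (infixl "\<stileturn>\<^sub>E" 70) where
  "f \<stileturn>\<^sub>E g = (fst f \<circ> snd g, snd f \<circ> snd g)"

definition E_right :: "'a dimap \<Rightarrow> 'a dimap \<Rightarrow> 'a dimap"  (infixl "\<turnstile>\<^sub>E" 70) where
  "f \<turnstile>\<^sub>E g = (snd f \<circ> fst g, snd f \<circ> snd g)"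

definition O_prec :: "'a \<Rightarrow> 'a dimap \<Rightarrow> 'a"  (infixl "\<prec>\<^sub>O" 75) where
  "x \<prec>\<^sub>O f = snd f x"

definition O_succ :: "'a \<Rightarrow> 'a dimap \<Rightarrow> 'a"  (infixl "\<succ>\<^sub>O" 75) where
  "x \<succ>\<^sub>O f = fst f x"

definition O_left :: "'a dimap \<Rightarrow> 'a dimap \<Rightarrow> 'a dimap"  (infixl "\<stileturn>\<^sub>O" 70) where
  "f \<stileturn>\<^sub>O g = g \<turnstile>\<^sub>E f"

definition O_right :: "'a dimap \<Rightarrow> 'a dimap \<Rightarrow> 'a dimap"  (infixl "\<turnstile>\<^sub>O" 70) where
  "f \<turnstile>\<^sub>O g = g \<stileturn>\<^sub>E f"

text \<open>The suffixes \<open>lt\<close> and \<open>rt\<close> stand for the superscripts \<open>\<triangleleft>\<close> and \<open>\<triangleright>\<close>.\<close>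

type_synonym 'a tri = "'a \<Rightarrow> 'a \<Rightarrow> 'a \<Rightarrow> 'a"

definition L_lt :: "'a tri \<Rightarrow> 'a tri \<Rightarrow> 'a tri \<Rightarrow> 'a \<Rightarrow> 'a \<Rightarrow> 'a dimap" where
  "L_lt t1 t2 t3 x y = ((\<lambda>z. t1 x y z), (\<lambda>z. t3 x y z))"

definition L_rt :: "'a tri \<Rightarrow> 'a tri \<Rightarrow> 'a tri \<Rightarrow> 'a \<Rightarrow> 'a \<Rightarrow> 'a dimap" where
  "L_rt t1 t2 t3 x y = ((\<lambda>z. t2 x y z), (\<lambda>z. t3 x y z))"

definition R_lt :: "'a tri \<Rightarrow> 'a tri \<Rightarrow> 'a tri \<Rightarrow> 'a \<Rightarrow> 'a \<Rightarrow> 'a dimap" where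
  "R_lt t1 t2 t3 x y = ((\<lambda>z. t2 z x y), (\<lambda>z. t1 z x y))"

definition R_rt :: "'a tri \<Rightarrow> 'a tri \<Rightarrow> 'a tri \<Rightarrow> 'a \<Rightarrow> 'a \<Rightarrow> 'a dimap" where
  "R_rt t1 t2 t3 x y = ((\<lambda>z. t3 z x y), (\<lambda>z. t1 z x y))"

definition L_mod :: "('r::comm_ring_1 \<Rightarrow> 'a::ab_group_add \<Rightarrow> 'a) \<Rightarrow> 'a tri \<Rightarrow> 'a tri \<Rightarrow> 'a tri
    \<Rightarrow> 'a dimap set" where
  "L_mod scale t1 t2 t3 = module.span (dimap_scale scale)
     ({L_lt t1 t2 t3 x y | x y. True} \<union> {L_rt t1 t2 t3 x y | x y. True})"

definition R_mod :: "('r::comm_ring_1 \<Rightarrow> 'a::ab_group_add \<Rightarrow> 'a) \<Rightarrow> 'a tri \<Rightarrow> 'a tri \<Rightarrow> 'a tri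
    \<Rightarrow> 'a dimap set" where
  "R_mod scale t1 t2 t3 = module.span (dimap_scale scale)
     ({R_lt t1 t2 t3 x y | x y. True} \<union> {R_rt t1 t2 t3 x y | x y. True})"

text \<open>The linear map \<open>*\<close> prescribed on the generators.  The generators may satisfy linear relations
  that the prescribed values do not satisfy, so these are predicates: such a map, if it exists, is
  uniquely determined on the module.\<close>

definition is_L_star :: "('r::comm_ring_1 \<Rightarrow> 'a::ab_group_add \<Rightarrow> 'a) \<Rightarrow> 'a tri \<Rightarrow> 'a tri \<Rightarrow> 'a tri
    \<Rightarrow> ('a dimap \<Rightarrow> 'a dimap) \<Rightarrow> bool" where
  "is_L_star scale t1 t2 t3 star \<longleftrightarrow>
     linear_map_on (dimap_scale scale) (L_mod scale t1 t2 t3) star \<and>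
     (\<forall>x y. star (L_lt t1 t2 t3 x y) = L_rt t1 t2 t3 y x) \<and>
     (\<forall>x y. star (L_rt t1 t2 t3 x y) = L_lt t1 t2 t3 y x)"

definition is_R_star :: "('r::comm_ring_1 \<Rightarrow> 'a::ab_group_add \<Rightarrow> 'a) \<Rightarrow> 'a tri \<Rightarrow> 'a tri \<Rightarrow> 'a tri
    \<Rightarrow> ('a dimap \<Rightarrow> 'a dimap) \<Rightarrow> bool" where
  "is_R_star scale t1 t2 t3 star \<longleftrightarrow>
     linear_map_on (dimap_scale scale) (R_mod scale t1 t2 t3) star \<and>
     (\<forall>x y. star (R_lt t1 t2 t3 x y) = R_rt t1 t2 t3 y x) \<and>
     (\<forall>x y. star (R_rt t1 t2 t3 x y) = R_lt t1 t2 t3 y x)"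

definition L_star_prec :: "('a dimap \<Rightarrow> 'a dimap) \<Rightarrow> 'a \<Rightarrow> 'a dimap \<Rightarrow> 'a" where
  "L_star_prec starL x l = starL l \<succ>\<^sub>E x"

definition L_star_succ :: "('a dimap \<Rightarrow> 'a dimap) \<Rightarrow> 'a \<Rightarrow> 'a dimap \<Rightarrow> 'a" where
  "L_star_succ starL x l = starL l \<prec>\<^sub>E x"

definition R_star_prec :: "('a dimap \<Rightarrow> 'a dimap) \<Rightarrow> 'a dimap \<Rightarrow> 'a \<Rightarrow> 'a" where
  "R_star_prec starR p x = x \<succ>\<^sub>O starR p"

definition R_star_succ :: "('a dimap \<Rightarrow> 'a dimap) \<Rightarrow> 'a dimap \<Rightarrow> 'a \<Rightarrow> 'a" where
  "R_star_succ starR p x = x \<prec>\<^sub>O starR p"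

text \<open>A matrix with rows \<open>(\<lambda>, x)\<close> and \<open>(y', \<rho>)\<close> is the nested pair \<open>((\<lambda>, x), (y', \<rho>))\<close>.  The lower left
  entry lies in the isomorphic copy \<open>'b\<close> of \<open>'a\<close>, where \<open>bar :: 'a \<Rightarrow> 'b\<close> is the isomorphism.\<close>

type_synonym ('a, 'b) mat22 = "('a dimap \<times> 'a) \<times> ('b \<times> 'a dimap)"

fun mat_scale :: "('r \<Rightarrow> 'a \<Rightarrow> 'a) \<Rightarrow> ('r \<Rightarrow> 'b \<Rightarrow> 'b) \<Rightarrow> 'r \<Rightarrow> ('a, 'b) mat22 \<Rightarrow> ('a, 'b) mat22" where
  "mat_scale scale scaleB r ((l, x), (y', p)) =
     ((dimap_scale scale r l, scale r x), (scaleB r y', dimap_scale scale r p))"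

definition mat_carrier :: "('r::comm_ring_1 \<Rightarrow> 'a::ab_group_add \<Rightarrow> 'a) \<Rightarrow> 'a tri \<Rightarrow> 'a tri \<Rightarrow> 'a tri
    \<Rightarrow> ('a, 'b) mat22 set" where
  "mat_carrier scale t1 t2 t3 =
     (L_mod scale t1 t2 t3 \<times> UNIV) \<times> (UNIV \<times> R_mod scale t1 t2 t3)"

fun mat_left :: "'a::ab_group_add tri \<Rightarrow> 'a tri \<Rightarrow> 'a tri \<Rightarrow> ('a dimap \<Rightarrow> 'a dimap) \<Rightarrow>
    ('a dimap \<Rightarrow> 'a dimap) \<Rightarrow> ('a \<Rightarrow> 'b::ab_group_add) \<Rightarrow>
    ('a, 'b) mat22 \<Rightarrow> ('a, 'b) mat22 \<Rightarrow> ('a, 'b) mat22" where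
  "mat_left t1 t2 t3 starL starR bar ((l1, x1), (y1', p1)) ((l2, x2), (y2', p2)) =
     (let y1 = inv bar y1'; y2 = inv bar y2' in
       ((l1 \<stileturn>\<^sub>E l2 + L_lt t1 t2 t3 x1 y2,
         l1 \<prec>\<^sub>E x2 + x1 \<prec>\<^sub>O p2),
        (bar (L_star_prec starL y1 l2) + bar (R_star_prec starR p1 y2),
         R_lt t1 t2 t3 y1 x2 + p1 \<stileturn>\<^sub>O p2)))"

fun mat_right :: "'a::ab_group_add tri \<Rightarrow> 'a tri \<Rightarrow> 'a tri \<Rightarrow> ('a dimap \<Rightarrow> 'a dimap) \<Rightarrow>
    ('a dimap \<Rightarrow> 'a dimap) \<Rightarrow> ('a \<Rightarrow> 'b::ab_group_add) \<Rightarrow>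
    ('a, 'b) mat22 \<Rightarrow> ('a, 'b) mat22 \<Rightarrow> ('a, 'b) mat22" where
  "mat_right t1 t2 t3 starL starR bar ((l1, x1), (y1', p1)) ((l2, x2), (y2', p2)) =
     (let y1 = inv bar y1'; y2 = inv bar y2' in
       ((l1 \<turnstile>\<^sub>E l2 + L_rt t1 t2 t3 x1 y2,
         l1 \<succ>\<^sub>E x2 + x1 \<succ>\<^sub>O p2),
        (bar (L_star_succ starL y1 l2) + bar (R_star_succ starR p1 y2),
         R_rt t1 t2 t3 y1 x2 + p1 \<turnstile>\<^sub>O p2)))"

fun mat_star :: "('a dimap \<Rightarrow> 'a dimap) \<Rightarrow> ('a dimap \<Rightarrow> 'a dimap) \<Rightarrow> ('a \<Rightarrow> 'b) \<Rightarrow>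
    ('a, 'b) mat22 \<Rightarrow> ('a, 'b) mat22" where
  "mat_star starL starR bar ((l, x), (y', p)) = ((starL l, inv bar y'), (bar x, starR p))"

definition mat_emb :: "'a::ab_group_add \<Rightarrow> ('a, 'b::ab_group_add) mat22" where
  "mat_emb x = ((0, x), (0, 0))"

lemma module_dimap_scale:
  fixes scale :: "'r::comm_ring_1 \<Rightarrow> 'a::ab_group_add \<Rightarrow> 'a"
  assumes "module scale"
  shows "module (dimap_scale scale)"
proof -
  interpret module scale by fact
  show ?thesis
    by unfold_locales (auto simp: dimap_scale_def prod_eq_iff fun_eq_iff algebra_simps)
qed

lemma subspace_DiEnd:
  fixes scale :: "'r::comm_ring_1 \<Rightarrow> 'a::ab_group_add \<Rightarrow> 'a"
  assumes "module scale"
  shows "module.subspace (dimap_scale scale) (DiEnd scale)"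
proof -
  interpret A: module scale by fact
  interpret E: module "dimap_scale scale" by (rule module_dimap_scale) fact
  show ?thesis
    unfolding E.subspace_def DiEnd_def
    by (auto simp: module_hom_iff dimap_scale_def A.module_axioms algebra_simps)
qed

lemma L_mod_R_mod_subset_DiEnd:
  assumes "assoc_triple_trisystem_2 scale t1 t2 t3"
  shows "L_mod scale t1 t2 t3 \<subseteq> DiEnd scale" and "R_mod scale t1 t2 t3 \<subseteq> DiEnd scale"
proof -
  interpret assoc_triple_trisystem_2 scale t1 t2 t3 by fact
  interpret E: module "dimap_scale scale" by (rule module_dimap_scale) (rule module_axioms)
  have S: "E.subspace (DiEnd scale)"
    by (rule subspace_DiEnd) (rule module_axioms)
  show "L_mod scale t1 t2 t3 \<subseteq> DiEnd scale"
    unfolding L_mod_def using trilinear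
    by (intro E.span_minimal S) (auto simp: DiEnd_def L_lt_def L_rt_def trilinear_map_def)
  show "R_mod scale t1 t2 t3 \<subseteq> DiEnd scale"
    unfolding R_mod_def using trilinear
    by (intro E.span_minimal S) (auto simp: DiEnd_def R_lt_def R_rt_def trilinear_map_def)
qed

end

theory Submission
  imports Defs
begin

text \<open>The trisystem identities, oriented towards \<open>{a,b,{c,d,e}\<^sub>j}\<^sub>i\<close>, form a rewriting system with the five
  normal forms \<open>(i,j) = (1,1), (2,1), (3,1), (3,2), (3,3)\<close>.  Applied to generators of \<open>\<LL>(A,A)\<close> and
  \<open>\<RR>(A,A)\<^sup>o\<^sup>p\<close> and extended linearly, it yields rules by which an element \<open>f\<close> and its image \<open>f\<^sup>*\<close> move
  past the triple products and past each other.  These rules decide every entry of the matrix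
  identities.\<close>

section \<open>Pairs formed by an element and its image under the star map\<close>

text \<open>The pairs \<open>(f, f\<^sup>*)\<close> are generated as a module, so that identities linear in \<open>f\<close> and \<open>f\<^sup>*\<close> can be proved by
  induction without carrying along the membership conditions needed for the linearity of \<open>*\<close>.\<close>

inductive star_pair :: "('r \<Rightarrow> 'a::ab_group_add \<Rightarrow> 'a) \<Rightarrow> ('a \<Rightarrow> 'a \<Rightarrow> 'a dimap) \<Rightarrow>
    ('a \<Rightarrow> 'a \<Rightarrow> 'a dimap) \<Rightarrow> 'a dimap \<Rightarrow> 'a dimap \<Rightarrow> bool"
  for scale g h where
  lt: "star_pair scale g h (g x y) (h y x)"
| rt: "star_pair scale g h (h x y) (g y x)"
| zero: "star_pair scale g h 0 0"
| add: "star_pair scale g h f m \<Longrightarrow> star_pair scale g h f' m' \<Longrightarrow> star_pair scale g h (f + f') (m + m')"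
| scale: "star_pair scale g h f m \<Longrightarrow>
    star_pair scale g h (dimap_scale scale r f) (dimap_scale scale r m)"

text \<open>The rules \<open>lt\<close> and \<open>rt\<close> are exchanged when the two components
  are swapped. Every rule proved for a pair thereby holds for the reversed pair too, and the star
  map becomes involutive.\<close>

lemma star_pair_sym: "star_pair scale g h f m \<Longrightarrow> star_pair scale g h m f"
  by (induction rule: star_pair.induct) (auto intro: star_pair.intros)

lemma linear_map_on_zero:
  assumes "linear_map_on s D f" "0 \<in> D"
  shows "f 0 = 0"
proof -
  have "f (0 + 0) = f 0 + f 0"
    using assms unfolding linear_map_on_def by blast
  then show ?thesis by simp
qed

text \<open>The inductively generated pairs are exactly the graph of the given star map on the span,
  so facts proved by induction on pairs become facts about \<open>star\<close>.\<close>

lemma star_pair_iff: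
  fixes scale :: "'r::comm_ring_1 \<Rightarrow> 'a::ab_group_add \<Rightarrow> 'a"
  defines "D g h \<equiv> module.span (dimap_scale scale) ({g x y | x y. True} \<union> {h x y | x y. True})"
  assumes "module scale"
    and lin: "linear_map_on (dimap_scale scale) (D g h) star"
    and star: "\<And>x y. star (g x y) = h y x" "\<And>x y. star (h x y) = g y x"
  shows "star_pair scale g h f m \<longleftrightarrow> f \<in> D g h \<and> m = star f"
proof
  interpret E: module "dimap_scale scale" by (rule module_dimap_scale) fact
  show forward: "star_pair scale g h f m \<Longrightarrow> f \<in> D g h \<and> m = star f" for f m
  proof (induction rule: star_pair.induct)
    case zero
    then show ?case using linear_map_on_zero[OF lin] by (simp add: D_def E.span_zero)
  next
    case (add f m f' m')
    then show ?case using lin by (auto simp: D_def linear_map_on_def intro: E.span_add)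
  next
    case (scale f m r)
    then show ?case using lin by (auto simp: D_def linear_map_on_def intro: E.span_scale)
  qed (auto simp: star D_def intro!: E.span_base)
  \<comment> \<open>Some partner is enough: \<open>forward\<close> identifies any partner of
    \<open>f\<close> with \<open>star f\<close>.\<close>
  have "f \<in> D g h \<Longrightarrow> \<exists>m. star_pair scale g h f m" for f
    unfolding D_def
  proof (induction rule: E.span_induct_alt)
    case base
    then show ?case by (blast intro: star_pair.zero)
  next
    case (step c x y)
    then obtain m where m: "star_pair scale g h y m" by blast
    obtain n where "star_pair scale g h x n"
      using step(1) by (blast intro: star_pair.lt star_pair.rt)
    then show ?case using m by (blast intro: star_pair.add star_pair.scale)
  qed
  then show "f \<in> D g h \<and> m = star f \<Longrightarrow> star_pair scale g h f m"
    using forward by blast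
qed

lemma fst_dimap_scale [simp]: "fst (dimap_scale s r f) x = s r (fst f x)"
  and snd_dimap_scale [simp]: "snd (dimap_scale s r f) x = s r (snd f x)"
  by (simp_all add: dimap_scale_def)

lemmas dimap_ops = E_prec_def E_succ_def E_left_def E_right_def O_prec_def O_succ_def
  O_left_def O_right_def L_star_prec_def L_star_succ_def R_star_prec_def R_star_succ_def
  L_lt_def L_rt_def R_lt_def R_rt_def

text \<open>Reduces anti-multiplicativity of the star map to generators in the left factor. The
  first component is linear in \<open>f\<close> for every \<open>b\<close>, composition being
  pointwise there; the second is linear in \<open>m\<close> because \<open>b'\<close> consists of
  linear maps.\<close>

lemma star_pair_comp:
  assumes "star_pair scale g h f m"
    and hom: "module_hom scale scale (fst b')" "module_hom scale scale (snd b')"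
    and "\<And>x y. star_pair scale g h (g x y \<stileturn>\<^sub>E b) (b' \<turnstile>\<^sub>E h y x)"
    and "\<And>x y. star_pair scale g h (h x y \<stileturn>\<^sub>E b) (b' \<turnstile>\<^sub>E g y x)"
  shows "star_pair scale g h (f \<stileturn>\<^sub>E b) (b' \<turnstile>\<^sub>E m)"
  using assms(1)
proof (induction rule: star_pair.induct)
  case zero
  have "0 \<stileturn>\<^sub>E b = 0" "b' \<turnstile>\<^sub>E 0 = 0"
    by (simp_all add: dimap_ops prod_eq_iff fun_eq_iff hom[THEN module_hom.zero])
  then show ?case by (simp add: star_pair.zero)
next
  case (add f m f' m')
  have "(f + f') \<stileturn>\<^sub>E b = f \<stileturn>\<^sub>E b + f' \<stileturn>\<^sub>E b" "b' \<turnstile>\<^sub>E (m + m') = b' \<turnstile>\<^sub>E m + b' \<turnstile>\<^sub>E m'"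
    by (simp_all add: dimap_ops prod_eq_iff fun_eq_iff hom[THEN module_hom.add])
  then show ?case using add by (simp add: star_pair.add)
next
  case (scale f m r)
  have "dimap_scale scale r f \<stileturn>\<^sub>E b = dimap_scale scale r (f \<stileturn>\<^sub>E b)"
    "b' \<turnstile>\<^sub>E dimap_scale scale r m = dimap_scale scale r (b' \<turnstile>\<^sub>E m)"
    by (simp_all add: dimap_ops prod_eq_iff fun_eq_iff hom[THEN module_hom.scale])
  then show ?case using scale by (simp add: star_pair.scale)
qed (simp_all add: assms(4,5))

section \<open>Exchange rules for left and right multiplications in a trisystem\<close>

context assoc_triple_trisystem_2
begin

lemma module_hom_t:
  "module_hom scale scale (\<lambda>x. t1 x y z)" "module_hom scale scale (\<lambda>y. t1 x y z)"
  "module_hom scale scale (\<lambda>z. t1 x y z)" "module_hom scale scale (\<lambda>x. t2 x y z)"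
  "module_hom scale scale (\<lambda>y. t2 x y z)" "module_hom scale scale (\<lambda>z. t2 x y z)"
  "module_hom scale scale (\<lambda>x. t3 x y z)" "module_hom scale scale (\<lambda>y. t3 x y z)"
  "module_hom scale scale (\<lambda>z. t3 x y z)"
  using trilinear by (simp_all add: trilinear_map_def)

lemmas t_linear = module_hom_t[THEN module_hom.add] module_hom_t[THEN module_hom.scale]
  module_hom_t[THEN module_hom.zero]

text \<open>In the first place the inner index matters only under outer index 1, in the middle place
  only under 2, in the last place only under 3. In the other cases \<open>tri6\<close> to
  \<open>tri11\<close> replace it by an index for which one of the associativity laws
  \<open>tri1\<close> to \<open>tri5\<close> applies.\<close>

lemma t_normalise:
  "t1 (t1 a b c) d e = t1 a b (t1 c d e)" "t1 (t2 a b c) d e = t2 a b (t1 c d e)"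
  "t1 (t3 a b c) d e = t3 a b (t1 c d e)" "t2 (t1 a b c) d e = t3 a b (t2 c d e)"
  "t2 (t2 a b c) d e = t3 a b (t2 c d e)" "t2 (t3 a b c) d e = t3 a b (t2 c d e)"
  "t3 (t1 a b c) d e = t3 a b (t3 c d e)" "t3 (t2 a b c) d e = t3 a b (t3 c d e)"
  "t3 (t3 a b c) d e = t3 a b (t3 c d e)"
  "t1 a (t1 d c b) e = t1 a b (t1 c d e)" "t1 a (t2 d c b) e = t1 a b (t1 c d e)"
  "t1 a (t3 d c b) e = t1 a b (t1 c d e)" "t2 a (t1 d c b) e = t3 a b (t2 c d e)"
  "t2 a (t2 d c b) e = t3 a b (t1 c d e)" "t2 a (t3 d c b) e = t2 a b (t1 c d e)"
  "t3 a (t1 d c b) e = t3 a b (t3 c d e)" "t3 a (t2 d c b) e = t3 a b (t3 c d e)"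
  "t3 a (t3 d c b) e = t3 a b (t3 c d e)"
  "t1 a b (t2 c d e) = t1 a b (t1 c d e)" "t1 a b (t3 c d e) = t1 a b (t1 c d e)"
  "t2 a b (t2 c d e) = t2 a b (t1 c d e)" "t2 a b (t3 c d e) = t2 a b (t1 c d e)"
  using tri1 tri2 tri3 tri4 tri5 tri6 tri7 tri8 tri9 tri10 tri11 by metis+

abbreviation "L_pair \<equiv> star_pair scale (L_lt t1 t2 t3) (L_rt t1 t2 t3)"
abbreviation "R_pair \<equiv> star_pair scale (R_lt t1 t2 t3) (R_rt t1 t2 t3)"

lemma L_pair_hom:
  "L_pair f m \<Longrightarrow> module_hom scale scale (fst f) \<and> module_hom scale scale (snd f)"
  by (induction rule: star_pair.induct)
    (auto simp: module_hom_iff L_lt_def L_rt_def t_linear module_axioms algebra_simps scale_left_commute)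

lemma R_pair_hom:
  "R_pair f m \<Longrightarrow> module_hom scale scale (fst f) \<and> module_hom scale scale (snd f)"
  by (induction rule: star_pair.induct)
    (auto simp: module_hom_iff R_lt_def R_rt_def t_linear module_axioms algebra_simps scale_left_commute)

text \<open>Each equation is linear in \<open>f\<close> and \<open>m\<close>, and on generators it
  is an instance of \<open>t_normalise\<close>. The reversed arguments in the middle place of the
  trisystem laws are the reason why \<open>m\<close> in that place turns into \<open>f\<close>
  acting on the last argument.\<close>

lemma L_pair_normalise:
  "L_pair f m \<Longrightarrow>
    (\<forall>x y z.
      fst f (t2 x y z) = fst f (t1 x y z) \<and> fst f (t3 x y z) = fst f (t1 x y z) \<and>
      t1 (fst f x) y z = fst f (t1 x y z) \<and> t1 (snd f x) y z = snd f (t1 x y z) \<and>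
      t2 (fst f x) y z = snd f (t2 x y z) \<and> t2 (snd f x) y z = snd f (t2 x y z) \<and>
      t3 (fst f x) y z = snd f (t3 x y z) \<and> t3 (snd f x) y z = snd f (t3 x y z) \<and>
      t1 x y (snd f z) = t1 x y (fst f z) \<and> t2 x y (snd f z) = t2 x y (fst f z) \<and>
      t1 x (fst m y) z = t1 x y (fst f z) \<and> t1 x (snd m y) z = t1 x y (fst f z) \<and>
      t2 x (fst m y) z = t3 x y (fst f z) \<and> t2 x (snd m y) z = t2 x y (fst f z) \<and>
      t3 x (fst m y) z = t3 x y (snd f z) \<and> t3 x (snd m y) z = t3 x y (snd f z))"
  by (induction rule: star_pair.induct) (simp_all add: L_lt_def L_rt_def t_linear t_normalise)

text \<open>Mirror image of the previous rules: \<open>q\<close> leaves the middle place and becomes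
  \<open>p\<close> acting on the first argument.\<close>

lemma R_pair_normalise:
  "R_pair p q \<Longrightarrow>
    (\<forall>x y z.
      fst p (t1 x y z) = t3 x y (fst p z) \<and> snd p (t1 x y z) = t1 x y (snd p z) \<and>
      fst p (t2 x y z) = t3 x y (fst p z) \<and> snd p (t2 x y z) = t2 x y (snd p z) \<and>
      fst p (t3 x y z) = t3 x y (fst p z) \<and> snd p (t3 x y z) = t3 x y (snd p z) \<and>
      t1 x y (fst p z) = t1 x y (snd p z) \<and> t2 x y (fst p z) = t2 x y (snd p z) \<and>
      t2 (snd p x) y z = t2 (fst p x) y z \<and> t3 (snd p x) y z = t3 (fst p x) y z \<and>
      t1 x (fst q y) z = t1 (snd p x) y z \<and> t1 x (snd q y) z = t1 (snd p x) y z \<and>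
      t2 x (fst q y) z = t1 (fst p x) y z \<and> t2 x (snd q y) z = t2 (fst p x) y z \<and>
      t3 x (fst q y) z = t3 (fst p x) y z \<and> t3 x (snd q y) z = t3 (fst p x) y z)"
  by (induction rule: star_pair.induct) (simp_all add: R_lt_def R_rt_def t_linear t_normalise)

text \<open>Gives closure under the product and anti-multiplicativity of the star map at once: a
  generator times \<open>g\<close> is again a generator, with the partner of \<open>g\<close>
  absorbed into its second argument.\<close>

lemma L_pair_comp:
  assumes "L_pair f m" "L_pair g n"
  shows "L_pair (f \<stileturn>\<^sub>E g) (n \<turnstile>\<^sub>E m)"
proof -
  note N = L_pair_normalise[rule_format, OF assms(2)]
    L_pair_normalise[rule_format, OF star_pair_sym[OF assms(2)]]
  \<comment> \<open>The component has to be \<open>snd n\<close>: in the middle place of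
    \<open>t2\<close>, \<open>fst n\<close> would turn the outer index into 3.\<close>
  have "L_lt t1 t2 t3 x y \<stileturn>\<^sub>E g = L_lt t1 t2 t3 x (snd n y)"
    "n \<turnstile>\<^sub>E L_rt t1 t2 t3 y x = L_rt t1 t2 t3 (snd n y) x"
    "L_rt t1 t2 t3 x y \<stileturn>\<^sub>E g = L_rt t1 t2 t3 x (snd n y)"
    "n \<turnstile>\<^sub>E L_lt t1 t2 t3 y x = L_lt t1 t2 t3 (snd n y) x" for x y
    by (simp_all add: dimap_ops prod_eq_iff fun_eq_iff N)
  then show ?thesis
    using assms(1) L_pair_hom[OF star_pair_sym[OF assms(2)]]
    by - (rule star_pair_comp, simp_all add: star_pair.lt star_pair.rt)
qed

lemma R_pair_comp:
  assumes "R_pair f m" "R_pair g n"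
  shows "R_pair (f \<stileturn>\<^sub>E g) (n \<turnstile>\<^sub>E m)"
proof -
  note N = R_pair_normalise[rule_format, OF assms(2)]
    R_pair_normalise[rule_format, OF star_pair_sym[OF assms(2)]]
  have "R_lt t1 t2 t3 x y \<stileturn>\<^sub>E g = R_lt t1 t2 t3 (snd n x) y"
    "n \<turnstile>\<^sub>E R_rt t1 t2 t3 y x = R_rt t1 t2 t3 y (snd n x)"
    "R_rt t1 t2 t3 x y \<stileturn>\<^sub>E g = R_rt t1 t2 t3 (snd n x) y"
    "n \<turnstile>\<^sub>E R_lt t1 t2 t3 y x = R_lt t1 t2 t3 y (snd n x)" for x y
    by (simp_all add: dimap_ops prod_eq_iff fun_eq_iff N)
  then show ?thesis
    using assms(1) R_pair_hom[OF star_pair_sym[OF assms(2)]]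
    by - (rule star_pair_comp, simp_all add: star_pair.lt star_pair.rt)
qed

text \<open>Makes the left action compatible with the product, \<open>(f \<stileturn>\<^sub>E g)
  \<prec>\<^sub>E x = f \<prec>\<^sub>E g \<prec>\<^sub>E x\<close>. It holds because
  \<open>fst f\<close> does not distinguish the three triple products.\<close>

lemma L_pair_L_pair:
  assumes "L_pair f m" "L_pair g n"
  shows "fst f (snd g x) = fst f (fst g x)"
  using assms(2)
  by (induction rule: star_pair.induct)
    (simp_all add: L_lt_def L_rt_def L_pair_normalise[rule_format, OF assms(1)]
      L_pair_hom[OF assms(1), THEN conjunct1, THEN module_hom.add]
      L_pair_hom[OF assms(1), THEN conjunct1, THEN module_hom.scale])

text \<open>The bimodule laws between the left and the right action on \<open>A\<close>, written in
  components.\<close>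

lemma L_pair_R_pair:
  assumes "L_pair f m" "R_pair p q"
  shows "fst f (fst p x) = fst f (snd p x)"
    and "fst p (fst f x) = snd f (fst p x)" "fst p (snd f x) = snd f (fst p x)"
    and "snd p (fst f x) = fst f (snd p x)" "snd p (snd f x) = snd f (snd p x)"
  using assms(2)
  by (induction rule: star_pair.induct)
    (simp_all add: R_lt_def R_rt_def L_pair_normalise[rule_format, OF assms(1)]
      L_pair_hom[OF assms(1), THEN conjunct1, THEN module_hom.add]
      L_pair_hom[OF assms(1), THEN conjunct1, THEN module_hom.scale]
      L_pair_hom[OF assms(1), THEN conjunct1, THEN module_hom.zero]
      L_pair_hom[OF assms(1), THEN conjunct2, THEN module_hom.add]
      L_pair_hom[OF assms(1), THEN conjunct2, THEN module_hom.scale]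
      L_pair_hom[OF assms(1), THEN conjunct2, THEN module_hom.zero])

lemma R_pair_R_pair:
  assumes "R_pair f m" "R_pair g n"
  shows "fst f (snd g x) = fst f (fst g x)"
  using assms(2)
  by (induction rule: star_pair.induct)
    (simp_all add: R_lt_def R_rt_def R_pair_normalise[rule_format, OF assms(1)]
      R_pair_hom[OF assms(1), THEN conjunct1, THEN module_hom.add]
      R_pair_hom[OF assms(1), THEN conjunct1, THEN module_hom.scale])

end

section \<open>The star maps on the two operator modules\<close>

locale star_trisystem = assoc_triple_trisystem_2 scale t1 t2 t3
  for scale :: "'r::comm_ring_1 \<Rightarrow> 'a::ab_group_add \<Rightarrow> 'a" and t1 t2 t3 +
  fixes scaleB :: "'r \<Rightarrow> 'b::ab_group_add \<Rightarrow> 'b" and bar :: "'a \<Rightarrow> 'b"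
    and starL starR :: "'a dimap \<Rightarrow> 'a dimap"
  assumes bar_hom: "module_hom scale scaleB bar" and bij_bar: "bij bar"
    and starL: "is_L_star scale t1 t2 t3 starL"
    and starR: "is_R_star scale t1 t2 t3 starR"
begin

abbreviation "L \<equiv> L_mod scale t1 t2 t3"
abbreviation "R \<equiv> R_mod scale t1 t2 t3"

lemma L_pair_iff: "L_pair f m \<longleftrightarrow> f \<in> L \<and> m = starL f"
  using starL unfolding is_L_star_def L_mod_def
  by (intro star_pair_iff) (auto intro: module_axioms)

lemma R_pair_iff: "R_pair f m \<longleftrightarrow> f \<in> R \<and> m = starR f"
  using starR unfolding is_R_star_def R_mod_def
  by (intro star_pair_iff) (auto intro: module_axioms)

lemma L_pair_starL: "f \<in> L \<Longrightarrow> L_pair f (starL f)"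
  and R_pair_starR: "p \<in> R \<Longrightarrow> R_pair p (starR p)"
  by (simp_all add: L_pair_iff R_pair_iff)

text \<open>Symmetry of the pairs says both that the image of the star map stays in the module and
  that applying the map twice gives the identity.\<close>

lemma star_star [simp]:
  "f \<in> L \<Longrightarrow> starL f \<in> L" "f \<in> L \<Longrightarrow> starL (starL f) = f"
  "p \<in> R \<Longrightarrow> starR p \<in> R" "p \<in> R \<Longrightarrow> starR (starR p) = p"
  using star_pair_sym[OF L_pair_starL] star_pair_sym[OF R_pair_starR]
  by (simp_all add: L_pair_iff R_pair_iff)

lemma star_generators [simp]:
  "L_lt t1 t2 t3 x y \<in> L" "starL (L_lt t1 t2 t3 x y) = L_rt t1 t2 t3 y x"
  "L_rt t1 t2 t3 x y \<in> L" "starL (L_rt t1 t2 t3 x y) = L_lt t1 t2 t3 y x"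
  "R_lt t1 t2 t3 x y \<in> R" "starR (R_lt t1 t2 t3 x y) = R_rt t1 t2 t3 y x"
  "R_rt t1 t2 t3 x y \<in> R" "starR (R_rt t1 t2 t3 x y) = R_lt t1 t2 t3 y x"
  using star_pair.lt[of scale "L_lt t1 t2 t3" "L_rt t1 t2 t3" x y]
    star_pair.rt[of scale "L_lt t1 t2 t3" "L_rt t1 t2 t3" x y]
    star_pair.lt[of scale "R_lt t1 t2 t3" "R_rt t1 t2 t3" x y]
    star_pair.rt[of scale "R_lt t1 t2 t3" "R_rt t1 t2 t3" x y]
  by (simp_all add: L_pair_iff R_pair_iff)

lemma star_module [simp]:
  "0 \<in> L" "starL 0 = 0" "0 \<in> R" "starR 0 = 0"
  "f \<in> L \<Longrightarrow> g \<in> L \<Longrightarrow> f + g \<in> L" "f \<in> L \<Longrightarrow> g \<in> L \<Longrightarrow> starL (f + g) = starL f + starL g"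
  "p \<in> R \<Longrightarrow> q \<in> R \<Longrightarrow> p + q \<in> R" "p \<in> R \<Longrightarrow> q \<in> R \<Longrightarrow> starR (p + q) = starR p + starR q"
  "f \<in> L \<Longrightarrow> dimap_scale scale r f \<in> L"
  "f \<in> L \<Longrightarrow> starL (dimap_scale scale r f) = dimap_scale scale r (starL f)"
  "p \<in> R \<Longrightarrow> dimap_scale scale r p \<in> R"
  "p \<in> R \<Longrightarrow> starR (dimap_scale scale r p) = dimap_scale scale r (starR p)"
  using star_pair.zero[of scale "L_lt t1 t2 t3" "L_rt t1 t2 t3"]
    star_pair.zero[of scale "R_lt t1 t2 t3" "R_rt t1 t2 t3"]
    star_pair.add[OF L_pair_starL L_pair_starL, of f g]
    star_pair.add[OF R_pair_starR R_pair_starR, of p q]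
    star_pair.scale[OF L_pair_starL, of f r] star_pair.scale[OF R_pair_starR, of p r]
  by (simp_all add: L_pair_iff R_pair_iff)

text \<open>The second product comes from the first one: \<open>L_pair_comp\<close> is applied to
  the reversed pairs of \<open>g\<close> and \<open>f\<close>, and the resulting pair is reversed
  again.\<close>

lemma star_comp [simp]:
  assumes "f \<in> L" "g \<in> L"
  shows "f \<stileturn>\<^sub>E g \<in> L" "starL (f \<stileturn>\<^sub>E g) = starL g \<turnstile>\<^sub>E starL f"
    "f \<turnstile>\<^sub>E g \<in> L" "starL (f \<turnstile>\<^sub>E g) = starL g \<stileturn>\<^sub>E starL f"
  using L_pair_comp[OF assms[THEN L_pair_starL]]
    L_pair_comp[OF assms(2,1)[THEN L_pair_starL, THEN star_pair_sym], THEN star_pair_sym]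
  by (simp_all add: L_pair_iff)

lemma star_comp_op [simp]:
  assumes "p \<in> R" "q \<in> R"
  shows "p \<stileturn>\<^sub>O q \<in> R" "starR (p \<stileturn>\<^sub>O q) = starR q \<turnstile>\<^sub>O starR p"
    "p \<turnstile>\<^sub>O q \<in> R" "starR (p \<turnstile>\<^sub>O q) = starR q \<stileturn>\<^sub>O starR p"
  using R_pair_comp[OF assms(2,1)[THEN R_pair_starR]]
    R_pair_comp[OF assms[THEN R_pair_starR, THEN star_pair_sym], THEN star_pair_sym]
  by (simp_all add: R_pair_iff O_left_def O_right_def)

lemmas L_normalise = L_pair_normalise[OF L_pair_starL]
lemmas R_normalise = R_pair_normalise[OF R_pair_starR]
lemmas LR_comp = L_pair_L_pair[OF L_pair_starL L_pair_starL] L_pair_R_pair[OF L_pair_starL R_pair_starR]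
  R_pair_R_pair[OF R_pair_starR R_pair_starR]

lemma hom_L: "f \<in> L \<Longrightarrow> module_hom scale scale (fst f)" "f \<in> L \<Longrightarrow> module_hom scale scale (snd f)"
  and hom_R: "p \<in> R \<Longrightarrow> module_hom scale scale (fst p)" "p \<in> R \<Longrightarrow> module_hom scale scale (snd p)"
  using L_pair_hom[OF L_pair_starL] R_pair_hom[OF R_pair_starR] by blast+

lemmas hom_LR = hom_L hom_R
lemmas LR_linear = hom_LR[THEN module_hom.add] hom_LR[THEN module_hom.scale] hom_LR[THEN module_hom.zero]

lemma inv_bar_bar [simp]: "inv bar (bar x) = x"
  using bij_bar by (simp add: bij_is_inj)

lemma bar_inv_bar [simp]: "bar (inv bar x) = x"
  using bij_bar by (simp add: bij_is_surj surj_f_inv_f)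

lemmas bar_linear [simp] = module_hom.add[OF bar_hom] module_hom.scale[OF bar_hom]
  module_hom.zero[OF bar_hom]

lemma scaleB_add: "scaleB r (u + v) = scaleB r u + scaleB r v"
  by (rule module.scale_right_distrib[OF module_hom.axioms(2)[OF bar_hom]])

lemma inv_bar_linear [simp]:
  "inv bar (u + v) = inv bar u + inv bar v" "inv bar (scaleB r u) = scale r (inv bar u)"
  "inv bar 0 = 0"
proof -
  show "inv bar (u + v) = inv bar u + inv bar v"
    by (metis bar_inv_bar bar_linear(1) inv_bar_bar)
  show "inv bar (scaleB r u) = scale r (inv bar u)"
    by (metis bar_inv_bar bar_linear(2) inv_bar_bar)
  show "inv bar 0 = 0"
    by (metis bar_linear(3) inv_bar_bar)
qed

section \<open>The dialgebra of matrices\<close>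

abbreviation "D \<equiv> mat_carrier scale t1 t2 t3 :: ('a, 'b) mat22 set"
abbreviation left (infixl "\<stileturn>" 70) where "left \<equiv> mat_left t1 t2 t3 starL starR bar"
abbreviation right (infixl "\<turnstile>" 70) where "right \<equiv> mat_right t1 t2 t3 starL starR bar"
abbreviation "star \<equiv> mat_star starL starR bar"
abbreviation "mscale \<equiv> mat_scale scale scaleB"

lemma mat_carrier_iff [simp]: "((l, x), (y', p)) \<in> D \<longleftrightarrow> l \<in> L \<and> p \<in> R"
  by (simp add: mat_carrier_def)

lemma mat_closed:
  "a \<in> D \<Longrightarrow> b \<in> D \<Longrightarrow> a \<stileturn> b \<in> D" "a \<in> D \<Longrightarrow> b \<in> D \<Longrightarrow> a \<turnstile> b \<in> D"
  by (cases a; cases b; force simp: Let_def mat_carrier_def)+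

lemma module_mat_scale: "module mscale"
proof -
  interpret B: module scaleB by (rule module_hom.axioms(2)[OF bar_hom])
  \<comment> \<open>The defining equation of \<open>mat_scale\<close> needs an explicit tuple; the
    form with projections applies to any matrix.\<close>
  have eq: "mscale r a = ((dimap_scale scale r (fst (fst a)), scale r (snd (fst a))),
      (scaleB r (fst (snd a)), dimap_scale scale r (snd (snd a))))" for r a
    by (cases a) (auto simp: split_paired_all)
  show "module mscale"
    by unfold_locales
      (simp_all add: eq prod_eq_iff fun_eq_iff algebra_simps)
qed

text \<open>With the lower left entry in the form \<open>bar y\<close>, every \<open>inv bar\<close>
  in the products cancels.\<close>

lemma mat_cases:
  assumes "a \<in> D"
  obtains l x y p where "a = ((l, x), (bar y, p))" "l \<in> L" "p \<in> R"
proof -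
  obtain l x y' p where a: "a = ((l, x), (y', p))"
    by (metis prod.collapse)
  show ?thesis
    by (rule that[of l x "inv bar y'" p]) (use assms a in simp_all)
qed

lemmas star_actions = L_star_prec_def L_star_succ_def R_star_prec_def R_star_succ_def

lemma bilinear_left: "bilinear_map_on mscale D left"
  and bilinear_right: "bilinear_map_on mscale D right"
proof -
  note simps = Let_def star_actions
  note simps' = dimap_ops prod_eq_iff fun_eq_iff t_linear LR_linear scaleB_add algebra_simps
  have add: "a \<stileturn> (b + c) = a \<stileturn> b + a \<stileturn> c" "(a + b) \<stileturn> c = a \<stileturn> c + b \<stileturn> c"
    "a \<turnstile> (b + c) = a \<turnstile> b + a \<turnstile> c" "(a + b) \<turnstile> c = a \<turnstile> c + b \<turnstile> c"
    if "a \<in> D" "b \<in> D" "c \<in> D" for a b c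
    using that by (elim mat_cases, simp add: simps, simp add: simps')+
  have scale: "a \<stileturn> mscale r b = mscale r (a \<stileturn> b)" "mscale r a \<stileturn> b = mscale r (a \<stileturn> b)"
    "a \<turnstile> mscale r b = mscale r (a \<turnstile> b)" "mscale r a \<turnstile> b = mscale r (a \<turnstile> b)"
    if "a \<in> D" "b \<in> D" for a b r
    using that by (elim mat_cases, simp add: simps, simp add: simps')+
  show "bilinear_map_on mscale D left" "bilinear_map_on mscale D right"
    using add scale by (simp_all add: bilinear_map_on_def linear_map_on_def mat_closed)
qed

text \<open>With three factors, and the diagonal entries evaluated at a point of \<open>A\<close>,
  each summand contains at most one triple product. Rules for a single operator against a triple
  product and for two operators against each other therefore suffice.\<close>

lemma mat_dialgebra:
  assumes "a \<in> D" "b \<in> D" "c \<in> D"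
  shows "(a \<stileturn> b) \<stileturn> c = a \<stileturn> (b \<stileturn> c)" "(a \<turnstile> b) \<stileturn> c = a \<turnstile> (b \<stileturn> c)"
    "(a \<turnstile> b) \<turnstile> c = a \<turnstile> (b \<turnstile> c)" "a \<stileturn> (b \<stileturn> c) = a \<stileturn> (b \<turnstile> c)"
    "(a \<stileturn> b) \<turnstile> c = (a \<turnstile> b) \<turnstile> c"
proof -
  note simps = Let_def star_actions
  \<comment> \<open>\<open>starL\<close> and \<open>starR\<close> must be pushed inward before the products are unfolded into components.\<close>
  note simps' = dimap_ops prod_eq_iff fun_eq_iff LR_comp LR_linear t_linear
  from assms obtain l1 x1 y1 p1 l2 x2 y2 p2 l3 x3 y3 p3 where
    abc: "a = ((l1, x1), (bar y1, p1))" "b = ((l2, x2), (bar y2, p2))" "c = ((l3, x3), (bar y3, p3))"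
    and [simp]: "l1 \<in> L" "p1 \<in> R" "l2 \<in> L" "p2 \<in> R" "l3 \<in> L" "p3 \<in> R"
    by (elim mat_cases)
  show "(a \<stileturn> b) \<stileturn> c = a \<stileturn> (b \<stileturn> c)"
    \<comment> \<open>After passing to components, elements of \<open>L\<close> are moved out of the
      first and middle places of triple products, then elements of \<open>R\<close> into the first
      and last places.\<close>
    by (simp add: abc simps, simp add: simps', simp add: L_normalise LR_comp,
        simp add: R_normalise LR_comp add_ac)
  show "(a \<turnstile> b) \<stileturn> c = a \<turnstile> (b \<stileturn> c)"
    by (simp add: abc simps, simp add: simps', simp add: L_normalise LR_comp,
        simp add: R_normalise LR_comp add_ac)
  show "(a \<turnstile> b) \<turnstile> c = a \<turnstile> (b \<turnstile> c)"
    by (simp add: abc simps, simp add: simps', simp add: L_normalise LR_comp,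
        simp add: R_normalise LR_comp add_ac)
  show "a \<stileturn> (b \<stileturn> c) = a \<stileturn> (b \<turnstile> c)"
    by (simp add: abc simps, simp add: simps', simp add: L_normalise LR_comp,
        simp add: R_normalise LR_comp add_ac)
  show "(a \<stileturn> b) \<turnstile> c = (a \<turnstile> b) \<turnstile> c"
    by (simp add: abc simps, simp add: simps', simp add: L_normalise LR_comp,
        simp add: R_normalise LR_comp add_ac)
qed

text \<open>On the diagonal this is anti-multiplicativity of \<open>starL\<close> and
  \<open>starR\<close>. Off the diagonal, the starred actions are by definition the actions of the
  starred elements from the other side.\<close>

lemma mat_involution: "dialgebra_involution mscale D left right star"
  unfolding dialgebra_involution_def linear_map_on_def
  by (intro conjI ballI allI; elim mat_cases; simp add: Let_def star_actions;
      simp add: dimap_ops prod_eq_iff fun_eq_iff add_ac)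

text \<open>The inner product has \<open>R_lt t1 t2 t3 y z\<close> or
  \<open>R_rt t1 t2 t3 y z\<close> as its only possibly nonzero entry, at the lower right, and the
  outer product lets it act on \<open>x\<close>.\<close>

lemma mat_triple:
  "mat_emb (t1 x y z) = mat_emb x \<stileturn> (star (mat_emb y) \<stileturn> mat_emb z)"
  "mat_emb (t2 x y z) = mat_emb x \<turnstile> (star (mat_emb y) \<stileturn> mat_emb z)"
  "mat_emb (t3 x y z) = mat_emb x \<turnstile> (star (mat_emb y) \<turnstile> mat_emb z)"
  by (simp_all add: mat_emb_def Let_def star_actions)
    (simp_all add: dimap_ops prod_eq_iff fun_eq_iff t_linear)

lemma assoc_dialgebra_mat: "assoc_dialgebra mscale D left right"
proof -
  interpret M: module mscale by (rule module_mat_scale)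
  have "M.subspace D"
    unfolding M.subspace_def
  proof (intro conjI ballI allI)
    show "0 \<in> D" by (simp add: mat_carrier_def mem_Times_iff)
  qed (elim mat_cases, simp)+
  then show ?thesis
    by unfold_locales (auto simp: bilinear_left bilinear_right intro: mat_dialgebra)
qed

end

theorem theorem17:
  fixes scale :: "'r::comm_ring_1 \<Rightarrow> 'a::ab_group_add \<Rightarrow> 'a"
    and scaleB :: "'r \<Rightarrow> 'b::ab_group_add \<Rightarrow> 'b"
    and t1 t2 t3 :: "'a \<Rightarrow> 'a \<Rightarrow> 'a \<Rightarrow> 'a"
    and bar :: "'a \<Rightarrow> 'b"
    and starL starR :: "'a dimap \<Rightarrow> 'a dimap"
  assumes half: "\<exists>h::'r. 2 * h = 1"
    and trisystem: "assoc_triple_trisystem_2 scale t1 t2 t3"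
    and copy: "module_hom scale scaleB bar" "bij bar"
    and starL: "is_L_star scale t1 t2 t3 starL"
    and starR: "is_R_star scale t1 t2 t3 starR"
  shows "let D = (mat_carrier scale t1 t2 t3 :: ('a, 'b) mat22 set);
             left = mat_left t1 t2 t3 starL starR bar;
             right = mat_right t1 t2 t3 starL starR bar;
             star = mat_star starL starR bar
         in assoc_dialgebra (mat_scale scale scaleB) D left right
          \<and> dialgebra_involution (mat_scale scale scaleB) D left right star
          \<and> (\<forall>x y z.
                mat_emb (t1 x y z) = left (mat_emb x) (left (star (mat_emb y)) (mat_emb z))
              \<and> mat_emb (t2 x y z) = right (mat_emb x) (left (star (mat_emb y)) (mat_emb z))
              \<and> mat_emb (t3 x y z) = right (mat_emb x) (right (star (mat_emb y)) (mat_emb z)))"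
proof -
  interpret star_trisystem scale t1 t2 t3 scaleB bar starL starR
    using trisystem copy starL starR by (simp add: star_trisystem_def star_trisystem_axioms_def)
  show ?thesis
    unfolding Let_def using assoc_dialgebra_mat mat_involution mat_triple by blast
qed

end
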